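(* Let $1\le p\le\infty$, let $A=(a_{nk})_{n,k\in\mathbb N_0}$ be an infinite real matrix, and define the matrix $C=(c_{nk})$ by $$c_{nk}=\frac1{\lambda_n}\sum_{i=0}^n(\lambda_i-\lambda_{i-1})\Big(\frac{f_i}{f_{i+1}}a_{ik}-\frac{f_{i+1}}{f_i}a_{i-1,k}\Big)\qquad(n,k\in\mathbb N_0).$$ Then $A$ belongs to any one of the classes $(c_0:\ell_p^{\lambda}(\widehat F))$, $(c:\ell_p^{\lambda}(\widehat F))$, $(\ell_\infty:\ell_p^{\lambda}(\widehat F))$, $(\ell_1:\ell_p^{\lambda}(\widehat F))$, $(\ell_p:\ell_1^{\lambda}(\widehat F))$, $(\ell_p:\ell_\infty^{\lambda}(\widehat F))$ if and only if $C$ belongs to the class $(c_0:\ell_p)$, $(c:\ell_p)$, $(\ell_\infty:\ell_p)$, $(\ell_1:\ell_p)$, $(\ell_p:\ell_1)$, $(\ell_p:\ell_\infty)$, respectively.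
   Context: $\mathbb N_0=\{0,1,2,\dots\}$; $\omega$ is the space of all real sequences $x=(x_k)_{k\in\mathbb N_0}$; $c_0$, $c$, $\ell_\infty$ are the spaces of null, convergent and bounded sequences. Fibonacci numbers: $f_0=f_1=1$, $f_n=f_{n-1}+f_{n-2}$ for $n\ge 2$. $\lambda=(\lambda_k)_{k\in\mathbb N_0}$ is a fixed strictly increasing sequence of positive reals with $\lambda_k\to\infty$. Terms with negative subscript are $0$ (so $\lambda_{-1}=0$, $x_{-1}=0$, $a_{-1,k}=0$). For $x\in\omega$ put $$E_n(x)=\frac1{\lambda_n}\sum_{k=0}^n(\lambda_k-\lambda_{k-1})\Big(\frac{f_k}{f_{k+1}}x_k-\frac{f_{k+1}}{f_k}x_{k-1}\Big),\qquad Ex=(E_n(x))_{n\in\mathbb N_0},$$ and $\ell_p^{\lambda}(\widehat F)=\{x\in\omega: Ex\in\ell_p\}$ for $1\le p\le\infty$. For sequence spaces $X,Y$, $A\in(X:Y)$ means that for every $x\in X$ the series $A_n(x)=\sum_ka_{nk}x_k$ converges for every $n$ and $(A_n(x))_n\in Y$. *)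

theory Defs
  imports Complex_Main "HOL-Library.Extended_Real" "HOL-Number_Theory.Fib"
begin

definition c_null :: "(nat \<Rightarrow> real) set" where
  "c_null = {x. x \<longlonglongrightarrow> 0}"

definition c_conv :: "(nat \<Rightarrow> real) set" where
  "c_conv = {x. convergent x}"

definition ell :: "ereal \<Rightarrow> (nat \<Rightarrow> real) set" where
  "ell p = (if p = \<infinity> then {x. Bseq x}
            else {x. summable (\<lambda>k. \<bar>x k\<bar> powr real_of_ereal p)})"

text \<open>Fibonacci numbers normalised by \<open>f 0 = f 1 = 1\<close>, whereas \<open>fib 0 = 0\<close>.\<close>

definition fibo :: "nat \<Rightarrow> real" where
  "fibo n = real (fib (Suc n))"

lemma fibo_recurrence:
  "fibo 0 = 1" "fibo (Suc 0) = 1" "fibo (Suc (Suc n)) = fibo (Suc n) + fibo n"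
  by (simp_all add: fibo_def)

text \<open>The term \<open>x\<^bsub>n-1\<^esub>\<close>, read as \<open>0\<close> when \<open>n = 0\<close>.\<close>

definition prev :: "(nat \<Rightarrow> real) \<Rightarrow> nat \<Rightarrow> real" where
  "prev x n = (case n of 0 \<Rightarrow> 0 | Suc m \<Rightarrow> x m)"

definition E_seq :: "(nat \<Rightarrow> real) \<Rightarrow> (nat \<Rightarrow> real) \<Rightarrow> nat \<Rightarrow> real" where
  "E_seq lam x n = 1 / lam n * (\<Sum>k=0..n. (lam k - prev lam k) *
     (fibo k / fibo (k + 1) * x k - fibo (k + 1) / fibo k * prev x k))"

definition ell_lam_F :: "(nat \<Rightarrow> real) \<Rightarrow> ereal \<Rightarrow> (nat \<Rightarrow> real) set" where
  "ell_lam_F lam p = {x. E_seq lam x \<in> ell p}"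

definition matrix_class ::
  "(nat \<Rightarrow> real) set \<Rightarrow> (nat \<Rightarrow> real) set \<Rightarrow> (nat \<Rightarrow> nat \<Rightarrow> real) set" where
  "matrix_class X Y = {A. \<forall>x\<in>X. (\<forall>n. summable (\<lambda>k. A n k * x k)) \<and>
     (\<lambda>n. \<Sum>k. A n k * x k) \<in> Y}"

definition C_matrix ::
  "(nat \<Rightarrow> real) \<Rightarrow> (nat \<Rightarrow> nat \<Rightarrow> real) \<Rightarrow> nat \<Rightarrow> nat \<Rightarrow> real" where
  "C_matrix lam A n k = 1 / lam n * (\<Sum>i=0..n. (lam i - prev lam i) *
     (fibo i / fibo (i + 1) * A i k - fibo (i + 1) / fibo i * prev (\<lambda>j. A j k) i))"

end

theory Submission
  imports Defs
begin

text \<open>Column \<open>k\<close> of \<open>C\<close> is the \<open>E\<close>-transform of column \<open>k\<close> of \<open>A\<close>, and \<open>E\<close> is a lower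
  triangular matrix with nonzero diagonal. Hence each row of \<open>C\<close> is a finite linear combination
  of rows of \<open>A\<close> and conversely, so that \<open>Ax\<close> exists iff \<open>Cx\<close> does, and then
  \<open>E (Ax) = Cx\<close>. The domain space plays no role in the argument.\<close>

lemma prev_simps [simp]: "prev x 0 = 0" "prev x (Suc n) = x n"
  by (simp_all add: prev_def)

lemma fibo_pos: "0 < fibo n"
  by (simp add: fibo_def fib_neq_0_nat)

lemma prev_sums:
  assumes "\<And>i. a i sums s i"
  shows "(\<lambda>k. prev (\<lambda>i. a i k) n) sums prev s n"
  using assms by (cases n) simp_all

text \<open>\<open>E_seq lam x n\<close> is a finite linear combination of the entries of
  \<open>x\<close> up to index \<open>n\<close>, so summing over \<open>k\<close> commutes with it
  by linearity of convergent series alone; absolute convergence is not involved.\<close>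

lemma E_seq_sums:
  assumes "\<And>i. a i sums s i"
  shows "(\<lambda>k. E_seq lam (\<lambda>i. a i k) n) sums E_seq lam s n"
  unfolding E_seq_def
  by (intro sums_mult sums_sum sums_diff assms prev_sums)

lemma prev_mult_right: "prev (\<lambda>i. x i * c) n = prev x n * c"
  by (cases n) simp_all

lemma E_seq_mult_right: "E_seq lam (\<lambda>i. x i * c) n = E_seq lam x n * c"
  unfolding E_seq_def prev_mult_right mult.assoc sum_distrib_right
  by (simp add: left_diff_distrib mult.assoc)

lemma C_matrix_eq_E_seq: "C_matrix lam A n k = E_seq lam (\<lambda>i. A i k) n"
  by (simp add: C_matrix_def E_seq_def)

text \<open>\<open>lam n * E_seq lam x n\<close> is a partial sum, so differencing isolates its last
  summand. At \<open>n = 0\<close> the convention \<open>prev _ 0 = 0\<close> makes this the whole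
  sum.\<close>

lemma E_seq_increment:
  assumes "\<And>n. lam n \<noteq> 0"
  shows "lam n * E_seq lam x n - prev (\<lambda>m. lam m * E_seq lam x m) n =
    (lam n - prev lam n) *
    (fibo n / fibo (n + 1) * x n - fibo (n + 1) / fibo n * prev x n)"
  using assms by (cases n) (simp_all add: E_seq_def)

text \<open>Inverts the transform recursively: dividing the increment by
  \<open>lam n - prev lam n\<close> leaves a two-term expression in \<open>x n\<close> and
  \<open>prev x n\<close>, which is solved for \<open>x n\<close>.\<close>

lemma E_seq_solve:
  assumes "\<And>n. lam n \<noteq> 0" and "lam n \<noteq> prev lam n"
  shows "x n = fibo (n + 1) / fibo n *
    ((lam n * E_seq lam x n - prev (\<lambda>m. lam m * E_seq lam x m) n) / (lam n - prev lam n) +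
     fibo (n + 1) / fibo n * prev x n)"
proof -
  have "lam n - prev lam n \<noteq> 0" "fibo n \<noteq> 0" "fibo (n + 1) \<noteq> 0"
    using assms(2) fibo_pos[of n] fibo_pos[of "n + 1"] by simp_all
  then show ?thesis
    unfolding E_seq_increment[of lam, OF assms(1)] by simp
qed

lemma summable_prev:
  assumes "\<And>m. m < n \<Longrightarrow> summable (a m)"
  shows "summable (\<lambda>k. prev (\<lambda>m. a m k) n)"
  using assms by (cases n) simp_all

text \<open>By \<open>E_seq_solve\<close> applied for each \<open>k\<close>, row \<open>n\<close> of
  \<open>a\<close> is a combination of transformed rows \<open>n\<close> and \<open>n - 1\<close>
  and of row \<open>n - 1\<close> of \<open>a\<close>, which is summable by induction.\<close>

lemma summable_of_summable_E_seq:
  assumes "\<And>n. lam n \<noteq> 0" and "\<And>n. lam n \<noteq> prev lam n"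
    and E: "\<And>n. summable (\<lambda>k. E_seq lam (\<lambda>i. a i k) n)"
  shows "summable (a n)"
proof (induction n rule: less_induct)
  case (less n)
  have "summable (\<lambda>k. fibo (n + 1) / fibo n *
    ((lam n * E_seq lam (\<lambda>i. a i k) n - prev (\<lambda>m. lam m * E_seq lam (\<lambda>i. a i k) m) n) /
       (lam n - prev lam n) +
     fibo (n + 1) / fibo n * prev (\<lambda>i. a i k) n))"
    by (intro summable_mult summable_add summable_divide summable_diff summable_prev E less)
  moreover have "a n = (\<lambda>k. fibo (n + 1) / fibo n *
    ((lam n * E_seq lam (\<lambda>i. a i k) n - prev (\<lambda>m. lam m * E_seq lam (\<lambda>i. a i k) m) n) /
       (lam n - prev lam n) +
     fibo (n + 1) / fibo n * prev (\<lambda>i. a i k) n))"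
    by (rule ext, rule E_seq_solve) (fact assms)+
  ultimately show ?case
    by (rule ssubst[rotated])
qed

lemma matrix_class_ell_lam_F_iff:
  assumes "\<And>n. lam n \<noteq> 0" and "\<And>n. lam n \<noteq> prev lam n"
  shows "A \<in> matrix_class X (ell_lam_F lam q) \<longleftrightarrow> C_matrix lam A \<in> matrix_class X (ell q)"
proof -
  \<comment> \<open>For fixed \<open>k\<close> the factor \<open>x k\<close> does not depend on the
    row index \<open>i\<close>, so it passes inside the transform.\<close>
  have C_mult: "C_matrix lam A n k * x k = E_seq lam (\<lambda>i. A i k * x k) n" for n k x
    by (simp add: C_matrix_eq_E_seq E_seq_mult_right)
  have C_sums: "(\<lambda>k. C_matrix lam A n k * x k) sums E_seq lam (\<lambda>i. \<Sum>k. A i k * x k) n"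
    if "\<And>i. summable (\<lambda>k. A i k * x k)" for n x
    unfolding C_mult by (intro E_seq_sums summable_sums that)
  have summable_iff: "(\<forall>n. summable (\<lambda>k. A n k * x k)) \<longleftrightarrow>
      (\<forall>n. summable (\<lambda>k. C_matrix lam A n k * x k))" for x
  proof
    assume "\<forall>n. summable (\<lambda>k. A n k * x k)"
    then show "\<forall>n. summable (\<lambda>k. C_matrix lam A n k * x k)"
      using C_sums sums_summable by blast
  next
    assume "\<forall>n. summable (\<lambda>k. C_matrix lam A n k * x k)"
    then have "summable (\<lambda>k. E_seq lam (\<lambda>i. A i k * x k) n)" for n
      by (simp add: C_mult)
    then show "\<forall>n. summable (\<lambda>k. A n k * x k)"
      using summable_of_summable_E_seq[where lam = lam, OF assms, where a = "\<lambda>i k. A i k * x k"] by blast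
  qed
  \<comment> \<open>The identity is needed only where the series converge: otherwise both sides of
    the next equivalence are false by \<open>summable_iff\<close>.\<close>
  have "E_seq lam (\<lambda>n. \<Sum>k. A n k * x k) = (\<lambda>n. \<Sum>k. C_matrix lam A n k * x k)"
    if "\<forall>n. summable (\<lambda>k. A n k * x k)" for x
    using sums_unique[OF C_sums] that by blast
  then have "(\<forall>n. summable (\<lambda>k. A n k * x k)) \<and>
        (\<lambda>n. \<Sum>k. A n k * x k) \<in> ell_lam_F lam q \<longleftrightarrow>
      (\<forall>n. summable (\<lambda>k. C_matrix lam A n k * x k)) \<and>
        (\<lambda>n. \<Sum>k. C_matrix lam A n k * x k) \<in> ell q" for x
    unfolding ell_lam_F_def summable_iff[symmetric] by auto
  then show ?thesis
    by (simp add: matrix_class_def)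
qed

theorem corollary4p11:
  fixes lam :: "nat \<Rightarrow> real" and p :: ereal and A :: "nat \<Rightarrow> nat \<Rightarrow> real"
  assumes "strict_mono lam"
    and "\<And>k. 0 < lam k"
    and "filterlim lam at_top sequentially"
    and "1 \<le> p"
  shows "(A \<in> matrix_class c_null (ell_lam_F lam p) \<longleftrightarrow> C_matrix lam A \<in> matrix_class c_null (ell p)) \<and>
    (A \<in> matrix_class c_conv (ell_lam_F lam p) \<longleftrightarrow> C_matrix lam A \<in> matrix_class c_conv (ell p)) \<and>
    (A \<in> matrix_class (ell \<infinity>) (ell_lam_F lam p) \<longleftrightarrow> C_matrix lam A \<in> matrix_class (ell \<infinity>) (ell p)) \<and>
    (A \<in> matrix_class (ell 1) (ell_lam_F lam p) \<longleftrightarrow> C_matrix lam A \<in> matrix_class (ell 1) (ell p)) \<and>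
    (A \<in> matrix_class (ell p) (ell_lam_F lam 1) \<longleftrightarrow> C_matrix lam A \<in> matrix_class (ell p) (ell 1)) \<and>
    (A \<in> matrix_class (ell p) (ell_lam_F lam \<infinity>) \<longleftrightarrow> C_matrix lam A \<in> matrix_class (ell p) (ell \<infinity>))"
proof -
  have nz: "lam n \<noteq> 0" for n
    using assms(2)[of n] by simp
  \<comment> \<open>Since \<open>prev lam 0 = 0\<close>, the case \<open>n = 0\<close> rests on
    positivity; the others use strict monotonicity.\<close>
  have inc: "lam n \<noteq> prev lam n" for n
  proof (cases n)
    case 0
    then show ?thesis
      using nz by simp
  next
    case (Suc m)
    then show ?thesis
      using strict_monoD[OF assms(1), of m n] by simp
  qed
  show ?thesis
    by (intro conjI matrix_class_ell_lam_F_iff nz inc)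
qed

end
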